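(* Let $g^\theta$ be an individually rational randomized matching mechanism for $n$ workers and $m$ firms, and let preference profiles $\succ$ be drawn from a given probability distribution on the set $P$ of preference profiles. Then $g^\theta$ is ex ante stable up to zero-measure events (i.e. the randomized matching $g^\theta(\succ)$ is ex ante stable with probability one over $\succ$) if and only if its expected stability violation satisfies $\mathit{STV}(g^\theta)=0$.
   Context: Setting. $W=\{1,\dots,n\}$ is a set of workers, $F=\{1,\dots,m\}$ a set of firms ($n,m\ge1$), $\overline F=F\cup\{\bot\}$, $\overline W=W\cup\{\bot\}$, where $\bot$ denotes being unmatched. Each worker $w$ has a strict preference order $\succ_w$ over $\overline F$, each firm $f$ a strict preference order $\succ_f$ over $\overline W$; agents ranked below $\bot$ are unacceptable. $P$ is the (finite) set of all preference profiles $\succ$. Mechanism. A randomized matching mechanism $g^\theta$ (with $\theta\in\mathbb R^d$ a parameter vector, e.g. neural network weights) maps each profile $\succ\in P$ to a randomized matching, described by marginal probabilities $g^\theta_{wf}(\succ)\in[0,1]$, $w\in W,f\in F$, with $\sum_{f\in F}g^\theta_{wf}(\succ)\le1$ for every $w$ and $\sum_{w\in W}g^\theta_{wf}(\succ)\le1$ for every $f$. Write $g^\theta_{w\bot}(\succ)=1-\sum_{f\in F}g^\theta_{wf}(\succ)$ and $g^\theta_{\bot f}(\succ)=1-\sum_{w\in W}g^\theta_{wf}(\succ)$. The mechanism is individually rational: $g^\theta_{wf}(\succ)=0$ whenever $\bot\succ_w f$ or $\bot\succ_f w$. Ex ante stability. With $r=g^\theta(\succ)$, $r$ causes ex ante justified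 envy at $\succ$ if (1) there are $w\in W$, $f\in F$, $f'\in\overline F$, $w'\in\overline W$ with $r_{wf'}>0$, $f\succ_w f'$, $r_{w'f}>0$ and $w\succ_f w'$; or (2) there are $w\in W$, $f'\in F$ with $r_{wf'}>0$ and $\bot\succ_w f'$, or $f\in F$, $w'\in W$ with $r_{w'f}>0$ and $\bot\succ_f w'$. It is ex ante stable if it causes no ex ante justified envy. Numerical representation of preferences. $p^\succ_{w\bot}=0$, $q^\succ_{\bot f}=0$, and for $w\in W$, $f\in F$, $$p^\succ_{wf}=\frac1m\Big(\mathbf 1_{f\succ_w\bot}+\sum_{j'=1}^m(\mathbf 1_{f\succ_w j'}-\mathbf 1_{\bot\succ_w j'})\Big),\qquad q^\succ_{wf}=\frac1n\Big(\mathbf 1_{w\succ_f\bot}+\sum_{i'=1}^n(\mathbf 1_{w\succ_f i'}-\mathbf 1_{\bot\succ_f i'})\Big),$$ where $\mathbf 1_X$ is the indicator of $X$. Stability violation. For $w\in W$, $f\in F$, $$\mathit{stv}_{wf}(g^\theta,\succ)=\Big(\sum_{w'\in\overline W}g^\theta_{w'f}(\succ)\max\{q^\succ_{wf}-q^\succ_{w'f},0\}\Big)\Big(\sum_{f'\in\overline F}g^\theta_{wf'}(\succ)\max\{p^\succ_{wf}-p^\succ_{wf'},0\}\Big),$$ $\mathit{stv}(g^\theta,\succ)=\frac12\big(\frac1m+\frac1n\big)\sum_{w=1}^n\sum_{f=1}^m\mathit{stv}_{wf}(g^\theta,\succ)$, and $\mathit{STV}(g^\theta)=\mathbb E_\succ[\mathit{stv}(g^\theta,\succ)]$,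 the expectation being over the given distribution on $P$. *)

theory Defs
  imports "HOL-Probability.Probability"
begin

text \<open>
  Workers and firms are the elements of two finite types, so that the number of workers is
  \<^term>\<open>CARD('w::finite)\<close>, the number of firms is \<^term>\<open>CARD('f::finite)\<close>, and both are positive.
  The outside option of being unmatched is \<^const>\<open>None\<close>.  In a preference relation, a pair
  \<open>(x, y)\<close> means that \<open>x\<close> is strictly preferred to \<open>y\<close>.
\<close>

type_synonym ('w, 'f) profile = "('w \<Rightarrow> 'f option rel) \<times> ('f \<Rightarrow> 'w option rel)"

definition profiles :: "('w, 'f) profile set" where
  "profiles = {s. (\<forall>w. strict_linear_order (fst s w)) \<and> (\<forall>f. strict_linear_order (snd s f))}"

definition worker_prefers ::
    "('w, 'f) profile \<Rightarrow> 'w \<Rightarrow> 'f option \<Rightarrow> 'f option \<Rightarrow> bool" where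
  "worker_prefers s w x y \<longleftrightarrow> (x, y) \<in> fst s w"

definition firm_prefers ::
    "('w, 'f) profile \<Rightarrow> 'f \<Rightarrow> 'w option \<Rightarrow> 'w option \<Rightarrow> bool" where
  "firm_prefers s f x y \<longleftrightarrow> (x, y) \<in> snd s f"

type_synonym ('w, 'f) rmatching = "'w \<Rightarrow> 'f \<Rightarrow> real"

definition randomized_matching :: "('w::finite, 'f::finite) rmatching \<Rightarrow> bool" where
  "randomized_matching r \<longleftrightarrow>
     (\<forall>w f. 0 \<le> r w f \<and> r w f \<le> 1) \<and>
     (\<forall>w. (\<Sum>f\<in>UNIV. r w f) \<le> 1) \<and>
     (\<forall>f. (\<Sum>w\<in>UNIV. r w f) \<le> 1)"

text \<open>
  Extension of the marginals to the outside options.  The last value is a dummy: the pair of the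
  two outside options never occurs below.
\<close>

fun marg :: "('w::finite, 'f::finite) rmatching \<Rightarrow> 'w option \<Rightarrow> 'f option \<Rightarrow> real" where
  "marg r (Some w) (Some f) = r w f"
| "marg r (Some w) None = 1 - (\<Sum>f\<in>UNIV. r w f)"
| "marg r None (Some f) = 1 - (\<Sum>w\<in>UNIV. r w f)"
| "marg r None None = 0"

type_synonym ('w, 'f) mechanism = "('w, 'f) profile \<Rightarrow> ('w, 'f) rmatching"

definition matching_mechanism :: "('w::finite, 'f::finite) mechanism \<Rightarrow> bool" where
  "matching_mechanism g \<longleftrightarrow> (\<forall>s\<in>profiles. randomized_matching (g s))"

definition individually_rational :: "('w::finite, 'f::finite) mechanism \<Rightarrow> bool" where
  "individually_rational g \<longleftrightarrow>
     (\<forall>s\<in>profiles. \<forall>w f.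
        worker_prefers s w None (Some f) \<or> firm_prefers s f None (Some w) \<longrightarrow> g s w f = 0)"

definition ex_ante_justified_envy ::
    "('w::finite, 'f::finite) rmatching \<Rightarrow> ('w, 'f) profile \<Rightarrow> bool" where
  "ex_ante_justified_envy r s \<longleftrightarrow>
     (\<exists>w f f' w'. marg r (Some w) f' > 0 \<and> worker_prefers s w (Some f) f' \<and>
        marg r w' (Some f) > 0 \<and> firm_prefers s f (Some w) w') \<or>
     (\<exists>w f'. r w f' > 0 \<and> worker_prefers s w None (Some f')) \<or>
     (\<exists>f w'. r w' f > 0 \<and> firm_prefers s f None (Some w'))"

definition ex_ante_stable ::
    "('w::finite, 'f::finite) rmatching \<Rightarrow> ('w, 'f) profile \<Rightarrow> bool" where
  "ex_ante_stable r s \<longleftrightarrow> \<not> ex_ante_justified_envy r s"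

fun worker_value :: "('w, 'f::finite) profile \<Rightarrow> 'w \<Rightarrow> 'f option \<Rightarrow> real" where
  "worker_value s w None = 0"
| "worker_value s w (Some f) =
     1 / real CARD('f) *
       (of_bool (worker_prefers s w (Some f) None) +
        (\<Sum>j\<in>UNIV. of_bool (worker_prefers s w (Some f) (Some j)) -
                   of_bool (worker_prefers s w None (Some j))))"

fun firm_value :: "('w::finite, 'f) profile \<Rightarrow> 'f \<Rightarrow> 'w option \<Rightarrow> real" where
  "firm_value s f None = 0"
| "firm_value s f (Some w) =
     1 / real CARD('w) *
       (of_bool (firm_prefers s f (Some w) None) +
        (\<Sum>i\<in>UNIV. of_bool (firm_prefers s f (Some w) (Some i)) -
                   of_bool (firm_prefers s f None (Some i))))"

definition stv_pair ::
    "('w::finite, 'f::finite) mechanism \<Rightarrow> ('w, 'f) profile \<Rightarrow> 'w \<Rightarrow> 'f \<Rightarrow> real" where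
  "stv_pair g s w f =
     (\<Sum>w'\<in>UNIV. marg (g s) w' (Some f) * max (firm_value s f (Some w) - firm_value s f w') 0) *
     (\<Sum>f'\<in>UNIV. marg (g s) (Some w) f' * max (worker_value s w (Some f) - worker_value s w f') 0)"

definition stv :: "('w::finite, 'f::finite) mechanism \<Rightarrow> ('w, 'f) profile \<Rightarrow> real" where
  "stv g s =
     1 / 2 * (1 / real CARD('f) + 1 / real CARD('w)) * (\<Sum>w\<in>UNIV. \<Sum>f\<in>UNIV. stv_pair g s w f)"

definition STV :: "('w::finite, 'f::finite) profile pmf \<Rightarrow> ('w, 'f) mechanism \<Rightarrow> real" where
  "STV D g = measure_pmf.expectation D (\<lambda>s. stv g s)"

end

theory Submission
  imports Defs
begin

text \<open>
  The value of an alternative is a shifted and rescaled count of the alternatives ranked below it, so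
  it represents the preference order. Hence both factors of \<open>stv\<^sub>w\<^sub>f\<close> are sums of nonnegative terms,
  and \<open>stv\<^sub>w\<^sub>f > 0\<close> means exactly that the pair \<open>(w, f)\<close> witnesses the first kind of justified envy;
  individual rationality excludes the second kind. A nonnegative random variable has expectation
  zero iff it vanishes almost surely.
\<close>

text \<open>If \<open>a\<close> is preferred to \<open>b\<close>, transitivity puts everything below
  \<open>b\<close> also below \<open>a\<close>, and by irreflexivity \<open>b\<close> itself lies
  only in the larger set, so the count grows strictly. Totality gives the converse.\<close>

lemma card_below_less_iff:
  fixes R :: "'a::finite rel"
  assumes "strict_linear_order R"
  shows "card {z. (y, z) \<in> R} < card {z. (x, z) \<in> R} \<longleftrightarrow> (x, y) \<in> R"
proof -
  have tr: "trans R" and ir: "irrefl R" and tot: "total R"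
    using assms by (auto simp: strict_linear_order_on_def)
  have mono: "card {z. (b, z) \<in> R} < card {z. (a, z) \<in> R}" if "(a, b) \<in> R" for a b
  proof (rule psubset_card_mono)
    have "{z. (b, z) \<in> R} \<subseteq> {z. (a, z) \<in> R}"
      using that tr by (auto dest: transD)
    moreover have "b \<in> {z. (a, z) \<in> R} - {z. (b, z) \<in> R}"
      using that ir by (auto simp: irrefl_def)
    ultimately show "{z. (b, z) \<in> R} \<subset> {z. (a, z) \<in> R}"
      by blast
  qed simp
  show ?thesis
  proof
    assume less: "card {z. (y, z) \<in> R} < card {z. (x, z) \<in> R}"
    then have "x \<noteq> y" by auto
    then have "(x, y) \<in> R \<or> (y, x) \<in> R"
      using tot by (auto simp: total_on_def)
    then show "(x, y) \<in> R"
      using mono[of y x] less by auto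
  qed (rule mono)
qed

lemma sum_UNIV_option:
  fixes h :: "'a::finite option \<Rightarrow> 'b::comm_monoid_add"
  shows "(\<Sum>z\<in>UNIV. h z) = h None + (\<Sum>x\<in>UNIV. h (Some x))"
  by (simp add: UNIV_option_conv sum.reindex)

text \<open>Separating the outside option brings the count into the shape of the value formulas: one
  indicator for \<open>None\<close> plus a sum over the actual agents.\<close>

lemma card_option_eq_sum:
  fixes P :: "'a::finite option \<Rightarrow> bool"
  shows "real (card {z. P z}) = of_bool (P None) + (\<Sum>x\<in>UNIV. of_bool (P (Some x)))"
proof -
  have "real (card {z. P z}) = (\<Sum>z\<in>UNIV. of_bool (P z))"
    by simp
  then show ?thesis
    by (simp only: sum_UNIV_option)
qed

text \<open>The leading indicator in the value is the \<open>None\<close> term of the count for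
  \<open>y\<close>. The count for \<open>None\<close> has no such term by irreflexivity, which is
  why the formula subtracts only a sum over firms.\<close>

lemma worker_value_eq_card:
  fixes s :: "('w, 'f::finite) profile"
  assumes "strict_linear_order (fst s w)"
  shows "worker_value s w y =
    (real (card {z. worker_prefers s w y z}) - real (card {z. worker_prefers s w None z})) / real CARD('f)"
proof -
  have "\<not> worker_prefers s w None None"
    using assms by (auto simp: strict_linear_order_on_def irrefl_def worker_prefers_def)
  then show ?thesis
    by (cases y) (simp_all only: worker_value.simps card_option_eq_sum sum_subtractf,
      simp_all add: diff_divide_distrib add_divide_distrib)
qed

lemma firm_value_eq_card:
  fixes s :: "('w::finite, 'f) profile"
  assumes "strict_linear_order (snd s f)"
  shows "firm_value s f y =
    (real (card {z. firm_prefers s f y z}) - real (card {z. firm_prefers s f None z})) / real CARD('w)"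
proof -
  have "\<not> firm_prefers s f None None"
    using assms by (auto simp: strict_linear_order_on_def irrefl_def firm_prefers_def)
  then show ?thesis
    by (cases y) (simp_all only: firm_value.simps card_option_eq_sum sum_subtractf,
      simp_all add: diff_divide_distrib add_divide_distrib)
qed

lemma worker_value_less_iff:
  fixes s :: "('w::finite, 'f::finite) profile"
  assumes "s \<in> profiles"
  shows "worker_value s w y < worker_value s w x \<longleftrightarrow> worker_prefers s w x y"
proof -
  have lin: "strict_linear_order (fst s w)"
    using assms by (simp add: profiles_def)
  show ?thesis
    \<comment> \<open>The shift by the count for \<open>None\<close> and the positive denominator
      are common to both values, so only the counts for \<open>x\<close> and \<open>y\<close> are
      compared.\<close>
    using card_below_less_iff[OF lin, of y x]
    by (simp add: worker_value_eq_card[OF lin] divide_less_cancel worker_prefers_def)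
qed

lemma firm_value_less_iff:
  fixes s :: "('w::finite, 'f::finite) profile"
  assumes "s \<in> profiles"
  shows "firm_value s f y < firm_value s f x \<longleftrightarrow> firm_prefers s f x y"
proof -
  have lin: "strict_linear_order (snd s f)"
    using assms by (simp add: profiles_def)
  show ?thesis
    using card_below_less_iff[OF lin, of y x]
    by (simp add: firm_value_eq_card[OF lin] divide_less_cancel firm_prefers_def)
qed

text \<open>At \<open>None\<close> this is the bound 1 on the total probability with which
  \<open>w\<close> is matched.\<close>

lemma marg_worker_nonneg: "randomized_matching r \<Longrightarrow> 0 \<le> marg r (Some w) y"
  by (cases y) (auto simp: randomized_matching_def)

lemma marg_firm_nonneg: "randomized_matching r \<Longrightarrow> 0 \<le> marg r x (Some f)"
  by (cases x) (auto simp: randomized_matching_def)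

lemma sum_mult_excess_eq_0_iff:
  fixes a v :: "'a::finite \<Rightarrow> real"
  assumes "\<And>x. 0 \<le> a x"
  shows "(\<Sum>x\<in>UNIV. a x * max (c - v x) 0) = 0 \<longleftrightarrow> \<not> (\<exists>x. 0 < a x \<and> v x < c)"
proof -
  have "a x * max (c - v x) 0 = 0 \<longleftrightarrow> \<not> (0 < a x \<and> v x < c)" for x
    using assms[of x] by (auto simp: max_def)
  then show ?thesis
    by (subst sum_nonneg_eq_0_iff) (auto simp: assms)
qed

context
  fixes g :: "('w::finite, 'f::finite) mechanism" and s :: "('w, 'f) profile"
  assumes mech: "matching_mechanism g" and s: "s \<in> profiles"
begin

lemma stv_pair_nonneg: "0 \<le> stv_pair g s w f"
proof -
  have "randomized_matching (g s)"
    using mech s by (simp add: matching_mechanism_def)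
  then show ?thesis
    unfolding stv_pair_def
    by (intro mult_nonneg_nonneg sum_nonneg) (auto simp: marg_worker_nonneg marg_firm_nonneg)
qed

lemma stv_nonneg: "0 \<le> stv g s"
  unfolding stv_def by (intro mult_nonneg_nonneg sum_nonneg stv_pair_nonneg) auto

lemma stv_eq_0_iff_pairs: "stv g s = 0 \<longleftrightarrow> (\<forall>w f. stv_pair g s w f = 0)"
proof -
  \<comment> \<open>The normalising factor must be nonzero, so that only the double sum of
    nonnegative terms can make \<open>stv\<close> vanish.\<close>
  have "1 / real CARD('f) + 1 / real CARD('w) > 0"
    by (intro add_pos_pos) auto
  then show ?thesis
    by (simp add: stv_def sum_nonneg_eq_0_iff sum_nonneg stv_pair_nonneg)
qed

text \<open>The product is nonzero iff both factors are. The first then supplies \<open>w'\<close>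
  and the second \<open>f'\<close>; neither choice constrains the other, so the two existential
  statements merge into one.\<close>

lemma stv_pair_eq_0_iff:
  "stv_pair g s w f = 0 \<longleftrightarrow>
    \<not> (\<exists>f' w'. marg (g s) (Some w) f' > 0 \<and> worker_prefers s w (Some f) f' \<and>
         marg (g s) w' (Some f) > 0 \<and> firm_prefers s f (Some w) w')"
proof -
  have "randomized_matching (g s)"
    using mech s by (simp add: matching_mechanism_def)
  note nonneg = marg_worker_nonneg[OF this] marg_firm_nonneg[OF this]
  show ?thesis
    unfolding stv_pair_def mult_eq_0_iff
      sum_mult_excess_eq_0_iff[of "\<lambda>w'. marg (g s) w' (Some f)", OF nonneg(2)]
      sum_mult_excess_eq_0_iff[of "marg (g s) (Some w)", OF nonneg(1)]
      worker_value_less_iff[OF s] firm_value_less_iff[OF s]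
    by blast
qed

lemma stv_eq_0_iff_ex_ante_stable:
  assumes "individually_rational g"
  shows "stv g s = 0 \<longleftrightarrow> ex_ante_stable (g s) s"
proof -
  have "\<not> (g s w f > 0 \<and> (worker_prefers s w None (Some f) \<or> firm_prefers s f None (Some w)))" for w f
    using assms s unfolding individually_rational_def by fastforce
  then show ?thesis
    unfolding ex_ante_stable_def ex_ante_justified_envy_def stv_eq_0_iff_pairs stv_pair_eq_0_iff
    by blast
qed

end

theorem theorem13:
  fixes g :: "(real ^ 'd) \<Rightarrow> ('w::finite, 'f::finite) mechanism"
    and \<theta> :: "real ^ 'd"
    and D :: "('w, 'f) profile pmf"
  assumes "set_pmf D \<subseteq> profiles"
    and "matching_mechanism (g \<theta>)"
    and "individually_rational (g \<theta>)"
  shows "(AE s in measure_pmf D. ex_ante_stable (g \<theta> s) s) \<longleftrightarrow> STV D (g \<theta>) = 0"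
proof -
  have "integrable (measure_pmf D) (stv (g \<theta>))"
    \<comment> \<open>Preference relations over finite types form a finite type, so the support of
      \<open>D\<close> is finite and no bound on \<open>stv\<close> is required.\<close>
    by (rule integrable_measure_pmf_finite) simp
  moreover have "AE s in measure_pmf D. 0 \<le> stv (g \<theta>) s"
    using assms stv_nonneg by (auto simp: AE_measure_pmf_iff)
  ultimately have "STV D (g \<theta>) = 0 \<longleftrightarrow> (AE s in measure_pmf D. stv (g \<theta>) s = 0)"
    unfolding STV_def by (rule integral_nonneg_eq_0_iff_AE)
  also have "\<dots> \<longleftrightarrow> (AE s in measure_pmf D. ex_ante_stable (g \<theta> s) s)"
    \<comment> \<open>Almost surely under \<open>D\<close> means everywhere on its support, which
      consists of valid profiles, so the pointwise equivalence applies.\<close>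
    using assms stv_eq_0_iff_ex_ante_stable[OF assms(2) _ assms(3)]
    by (auto simp: AE_measure_pmf_iff)
  finally show ?thesis by simp
qed

end
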